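(* Let $M = \int_0^1 \frac{\psi(t+1)+\gamma}{t}\,dt$. Then all of the following hold: (a) $\sum_{n=1}^{\infty} \frac{(-1)^{n-1}\zeta(n+1)}{n} = M$; (b) $\sum_{n=1}^{\infty} \frac{1}{n}\ln\left(1+\frac{1}{n}\right) = M$; (c) $\sum_{n=1}^{\infty} \frac{\ln(n+1)}{n(n+1)} = M$; (d) $\sum_{n=1}^{\infty} H_n(\zeta(n+1)-1) = M$; (e) $\sum_{n=2}^{\infty} H_n(\zeta(n)-1) = M + 1 - \gamma$; (f) $\sum_{n=1}^{\infty} \frac{1}{n}\left(n - \zeta(2)-\zeta(3)-\dots-\zeta(n)\right) = M$, where the $n=1$ term is $1$; (g) $\sum_{n=1}^{\infty} H_n^-(\zeta(n+1)-\zeta(n+2)) = M - \ln 2$; (h) $\int_0^{\infty} \frac{\mathrm{Ein}(x)}{e^x-1}\,dx = M$; (i) $\int_0^1 \frac{(1-u)\ln(1-u)}{u\ln u}\,du = M$; (j) $\sum_{n=1}^{\infty} \frac{1}{n2^n}\left\{\sum_{k=1}^{n}\binom{n}{k}(-1)^{k-1}\zeta(k+1)\right\} = M$.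
   Context: $\psi = \Gamma'/\Gamma$ is the digamma function and $\gamma=-\psi(1)$ is Euler's constant. $\zeta(s)=\sum_{n\ge1} n^{-s}$ is the Riemann zeta function. $H_n = 1+\frac12+\dots+\frac1n$ for $n\ge1$, $H_0=0$ (harmonic numbers). $H_n^- = 1-\frac12+\frac13-\dots+\frac{(-1)^{n-1}}{n}$ for $n\ge1$, $H_0^-=0$ (skew-harmonic numbers). $\mathrm{Ein}(x)=\sum_{n=1}^\infty \frac{(-1)^{n-1}x^n}{n!\,n}$ is the modified exponential integral (an entire function). *)

theory Defs
  imports "HOL-Analysis.Analysis"
begin

(* The series converges only for s > 1; no analytic continuation is intended. *)
definition zeta :: "real \<Rightarrow> real" where
  "zeta s = (\<Sum>n. real (Suc n) powr (- s))"

definition skew_harm :: "nat \<Rightarrow> real" where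
  "skew_harm n = (\<Sum>k=1..n. (-1) ^ (k - 1) / real k)"

definition Ein :: "real \<Rightarrow> real" where
  "Ein x = (\<Sum>n. (-1) ^ n * x ^ Suc n / (fact (Suc n) * real (Suc n)))"

definition sums_from :: "nat \<Rightarrow> (nat \<Rightarrow> real) \<Rightarrow> real \<Rightarrow> bool" where
  "sums_from m f s \<longleftrightarrow> (\<lambda>n. f (n + m)) sums s"

end

theory Submission
  imports Defs
begin

text \<open>
  Everything reduces to \<open>S = (\<Sum>n\<ge>1. ln (1 + 1/n) / n)\<close>. Since
  \<open>(\<psi>(t + 1) + \<gamma>) / t = (\<Sum>n\<ge>1. 1 / (n (n + t)))\<close>, integrating termwise gives \<open>M = S\<close>.
  Expanding \<open>\<zeta>(k) - 1 = (\<Sum>m\<ge>2. m\<^sup>-\<^sup>k)\<close>, each of the zeta series becomes a double series whose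
  inner sum over the exponent is an elementary logarithm at \<open>1/m\<close>; on \<open>m \<ge> 2\<close> the double
  series converges absolutely, and in (a) the conditionally convergent part \<open>m = 1\<close> is the
  alternating harmonic series \<open>ln 2\<close>.
  Both integrals follow from Tonelli's theorem, using \<open>Ein x = \<integral>\<^sub>0\<^sup>1 (1 - e\<^sup>-\<^sup>x\<^sup>t) / t dt\<close> and
  \<open>(u - 1) / (u ln u) = \<integral>\<^sub>0\<^sup>1 u\<^sup>t\<^sup>-\<^sup>1 dt\<close>: for fixed \<open>t\<close> the integral in the other variable is
  \<open>(\<psi>(t + 1) + \<gamma>) / t\<close>.
\<close>

section \<open>Interchanging double series; powers of reciprocals and zeta\<close>

text \<open>The product majorant makes \<open>f\<close> absolutely summable over all pairs. Both
  iterated sums then equal the unordered sum, so \<open>has_sum\<close> serves as the bridge between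
  the two orders of \<open>sums\<close>.\<close>

lemma sums_swap_dominated:
  fixes f :: "nat \<Rightarrow> nat \<Rightarrow> real"
  assumes bound: "\<And>m n. \<bar>f m n\<bar> \<le> g m * h n"
    and g: "summable g" "\<And>m. g m \<ge> 0" and h: "summable h" "\<And>n. h n \<ge> 0"
    and rows: "\<And>m. f m sums a m" and cols: "\<And>n. (\<lambda>m. f m n) sums b n"
    and a: "a sums S"
  shows "b sums S"
proof -
  have h_sum: "(h has_sum suminf h) UNIV"
    using h by (intro sums_nonneg_imp_has_sum summable_sums)
  have g_sum: "(g has_sum suminf g) UNIV"
    using g by (intro sums_nonneg_imp_has_sum summable_sums)
  have "(\<lambda>p. norm (g (fst p) * h (snd p))) summable_on UNIV \<times> UNIV"
  proof (subst Infinite_Sum.abs_summable_on_Sigma_iff, intro conjI ballI)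
    fix m
    show "(\<lambda>n. norm (g (fst (m, n)) * h (snd (m, n)))) summable_on UNIV"
      using has_sum_cmult_right[OF h_sum, of "g m"] g h
      by (auto simp: abs_mult summable_on_def)
  next
    have "(\<Sum>\<^sub>\<infinity>n. norm (g (fst (m, n)) * h (snd (m, n)))) = g m * suminf h" for m
      using infsumI[OF has_sum_cmult_right[OF h_sum, of "g m"]] g h by (simp add: abs_mult)
    then show "(\<lambda>m. norm (\<Sum>\<^sub>\<infinity>n. norm (g (fst (m, n)) * h (snd (m, n))))) summable_on UNIV"
      using has_sum_cmult_left[OF g_sum, of "suminf h"] g h suminf_nonneg[OF h]
      by (auto simp: abs_mult summable_on_def)
  qed
  then have "(\<lambda>p. norm (f (fst p) (snd p))) summable_on UNIV \<times> UNIV"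
    using g h bound by (elim Infinite_Sum.abs_summable_on_comparison_test) (auto simp: abs_mult)
  then obtain S' where S': "((\<lambda>p. f (fst p) (snd p)) has_sum S') (UNIV \<times> UNIV)"
    using abs_summable_summable summable_on_def by blast
  have row: "(f m has_sum a m) UNIV" for m
    using rows by (intro norm_summable_imp_has_sum
        summable_comparison_test'[OF summable_mult[OF h(1), of "g m"]]) (auto simp: bound)
  have col: "((\<lambda>m. f m n) has_sum b n) UNIV" for n
    using cols by (intro norm_summable_imp_has_sum
        summable_comparison_test'[OF summable_mult2[OF g(1), of "h n"]]) (auto simp: bound)
  have "(a has_sum S') UNIV"
    by (rule has_sum_SigmaD[OF S']) (use row in auto)
  then have "S' = S"
    using a has_sum_imp_sums sums_unique2 by blast
  have "((\<lambda>p. f (snd p) (fst p)) has_sum S') (UNIV \<times> UNIV)"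
    using S' by (subst has_sum_swap) (simp add: case_prod_unfold)
  then have "(b has_sum S') UNIV"
    by (rule has_sum_SigmaD) (use col in auto)
  with \<open>S' = S\<close> show ?thesis
    using has_sum_imp_sums by blast
qed

lemma zeta_sums:
  assumes "k \<ge> 2"
  shows "(\<lambda>m. (1 / real (m + 1)) ^ k) sums zeta (real k)"
proof -
  have "real (Suc m) powr (- real k) = (1 / real (m + 1)) ^ k" for m
    by (simp add: powr_minus powr_realpow inverse_eq_divide power_divide del: of_nat_Suc)
  moreover have "summable (\<lambda>m. (1 / real (m + 1)) ^ k)"
    using summable_ignore_initial_segment[OF inverse_power_summable[OF assms, where 'a = real], of 1]
    by (simp add: power_divide inverse_eq_divide)
  ultimately show ?thesis
    by (simp add: zeta_def summable_sums)
qed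

lemma zeta_minus_1_sums:
  assumes "k \<ge> 2"
  shows "(\<lambda>m. (1 / real (m + 2)) ^ k) sums (zeta (real k) - 1)"
proof -
  have "(\<lambda>m. (1 / real (Suc m + 1)) ^ k) sums (zeta (real k) - 1)"
    by (subst sums_Suc_iff) (use zeta_sums[OF assms] in simp)
  then show ?thesis by simp
qed

text \<open>Bases start at 1/2, so splitting off two powers leaves the majorant (m+2)^-2 * 2^-n. The
  factor n + 1 admits coefficients that grow like harmonic numbers, since the sum of (n+1) / 2^n is
  finite. The base 1 would have no decay in n, which is why \<open>zeta\<close> enters with 1
  subtracted.\<close>

lemma sums_swap_inverse_powers:
  fixes c :: "nat \<Rightarrow> nat \<Rightarrow> real"
  assumes bound: "\<And>m n. \<bar>c m n\<bar> \<le> 2 * real (n + 1)"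
    and rows: "\<And>m. (\<lambda>n. c m n * (1 / real (m + 2)) ^ (n + 2)) sums a m"
    and cols: "\<And>n. (\<lambda>m. c m n * (1 / real (m + 2)) ^ (n + 2)) sums b n"
    and a: "a sums S"
  shows "b sums S"
proof (rule sums_swap_dominated[OF _ _ _ _ _ rows cols a])
  show "summable (\<lambda>m. (1 / real (m + 2)) ^ 2)"
    using zeta_minus_1_sums[of 2] sums_summable by blast
  show "summable (\<lambda>n. 2 * (real (n + 1) * (1 / 2) ^ n))"
    using sums_summable[OF geometric_deriv_sums[of "1 / 2 :: real"]] by (intro summable_mult) simp
  show "\<bar>c m n * (1 / real (m + 2)) ^ (n + 2)\<bar>
      \<le> (1 / real (m + 2)) ^ 2 * (2 * (real (n + 1) * (1 / 2) ^ n))" for m n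
  proof -
    have "(1 / real (m + 2)) ^ n \<le> (1 / 2) ^ n"
      by (intro power_mono) (auto simp: field_simps)
    then have "\<bar>c m n\<bar> * ((1 / real (m + 2)) ^ 2 * (1 / real (m + 2)) ^ n)
        \<le> 2 * real (n + 1) * ((1 / real (m + 2)) ^ 2 * (1 / 2) ^ n)"
      by (intro mult_mono mult_left_mono bound) auto
    then show ?thesis
      by (simp only: abs_mult power_add abs_of_nonneg zero_le_power zero_le_divide_1_iff of_nat_0_le_iff mult_ac)
  qed
qed auto

section \<open>Logarithm series and generating functions of harmonic numbers\<close>

lemma ln_one_plus_sums:
  fixes x :: real
  assumes "\<bar>x\<bar> < 1"
  shows "(\<lambda>n. (-1) ^ n * x ^ (n + 1) / real (n + 1)) sums ln (1 + x)"
proof -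
  have "(\<lambda>n. - ((- x) ^ Suc n) / real (Suc n)) sums ln (1 + x)"
    by (subst sums_Suc_iff) (use ln_series'[OF assms] in simp)
  then show ?thesis
    by (simp add: power_minus[of x] mult_ac)
qed

lemma neg_ln_one_minus_sums:
  fixes x :: real
  assumes "\<bar>x\<bar> < 1"
  shows "(\<lambda>n. x ^ (n + 1) / real (n + 1)) sums - ln (1 - x)"
proof -
  have "(\<lambda>n. - ((-1) ^ n * (- x) ^ (n + 1) / real (n + 1))) sums - ln (1 - x)"
    using sums_minus[OF ln_one_plus_sums[of "- x"]] assms by simp
  also have "(\<lambda>n. - ((-1) ^ n * (- x) ^ (n + 1) / real (n + 1))) = (\<lambda>n. x ^ (n + 1) / real (n + 1))"
  proof
    fix n
    have "(-1) ^ n * (- x) ^ (n + 1) = - (x ^ (n + 1))"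
      unfolding power_minus[of x "n + 1"] by simp
    then show "- ((-1) ^ n * (- x) ^ (n + 1) / real (n + 1)) = x ^ (n + 1) / real (n + 1)"
      by simp
  qed
  finally show ?thesis .
qed

text \<open>Cauchy product with the geometric series: multiplying by 1 / (1 - x) replaces
  coefficients by their partial sums. The bound on \<open>c\<close> gives the absolute convergence
  that the product requires.\<close>

lemma partial_sums_generating_function:
  fixes c :: "nat \<Rightarrow> real"
  assumes x: "\<bar>x\<bar> < 1" and c: "\<And>n. \<bar>c n\<bar> \<le> 1" and "(\<lambda>n. c n * x ^ (n + 1)) sums A"
  shows "(\<lambda>n. (\<Sum>i\<le>n. c i) * x ^ (n + 1)) sums (A / (1 - x))"
proof -
  have geo: "summable (\<lambda>n. \<bar>x\<bar> ^ n)"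
    using x by (intro summable_geometric) simp
  have "summable (\<lambda>n. norm (c n * x ^ (n + 1)))"
  proof (rule summable_comparison_test')
    fix n :: nat
    have "\<bar>c n\<bar> * \<bar>x\<bar> ^ (n + 1) \<le> 1 * \<bar>x\<bar> ^ n"
      using x by (intro mult_mono power_decreasing c) auto
    then show "norm (norm (c n * x ^ (n + 1))) \<le> \<bar>x\<bar> ^ n"
      by (simp add: abs_mult power_abs)
  qed (rule geo)
  moreover have "summable (\<lambda>n. norm (x ^ n))"
    using geo by (simp add: power_abs)
  ultimately have "(\<lambda>n. \<Sum>i\<le>n. c i * x ^ (i + 1) * x ^ (n - i)) sums
      ((\<Sum>n. c n * x ^ (n + 1)) * (\<Sum>n. x ^ n))"
    by (rule Cauchy_product_sums)
  moreover have "(\<Sum>i\<le>n. c i * x ^ (i + 1) * x ^ (n - i)) = (\<Sum>i\<le>n. c i) * x ^ (n + 1)" for n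
    unfolding sum_distrib_right
  proof (rule sum.cong)
    fix i assume "i \<in> {..n}"
    then have "x ^ (i + 1) * x ^ (n - i) = x ^ (n + 1)"
      unfolding power_add[symmetric] by simp
    then show "c i * x ^ (i + 1) * x ^ (n - i) = c i * x ^ (n + 1)"
      by (simp only: mult.assoc)
  qed simp
  moreover have "(\<Sum>n. c n * x ^ (n + 1)) = A"
    using assms(3) sums_unique by metis
  ultimately show ?thesis
    using suminf_geometric[of x] x by simp
qed

lemma harm_generating_function:
  fixes x :: real
  assumes "\<bar>x\<bar> < 1"
  shows "(\<lambda>n. harm (n + 1) * x ^ (n + 1)) sums (- ln (1 - x) / (1 - x))"
proof -
  have "(\<Sum>i\<le>n. 1 / real (i + 1)) = harm (n + 1)" for n
    by (induction n) (auto simp: harm_Suc inverse_eq_divide harm_expand(1))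
  with partial_sums_generating_function[OF assms, of "\<lambda>n. 1 / real (n + 1)" "- ln (1 - x)"]
    neg_ln_one_minus_sums[OF assms]
  show ?thesis by simp
qed

lemma skew_harm_Suc: "skew_harm (Suc n) = skew_harm n + (-1) ^ n / real (Suc n)"
  by (simp add: skew_harm_def)

lemma skew_harm_generating_function:
  fixes x :: real
  assumes "\<bar>x\<bar> < 1"
  shows "(\<lambda>n. skew_harm (n + 1) * x ^ (n + 1)) sums (ln (1 + x) / (1 - x))"
proof -
  have "(\<Sum>i\<le>n. (-1) ^ i / real (i + 1)) = skew_harm (n + 1)" for n
    by (induction n) (auto simp: skew_harm_Suc, simp add: skew_harm_def)
  with partial_sums_generating_function[OF assms, of "\<lambda>n. (-1) ^ n / real (n + 1)"]
    ln_one_plus_sums[OF assms]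
  show ?thesis by (simp add: abs_divide power_abs)
qed

text \<open>A crude bound is enough, because \<open>sums_swap_inverse_powers\<close> tolerates
  linear growth of the coefficients.\<close>

lemma abs_skew_harm_le: "\<bar>skew_harm n\<bar> \<le> real n"
proof (induction n)
  case (Suc n)
  have "\<bar>skew_harm (Suc n)\<bar> \<le> \<bar>skew_harm n\<bar> + \<bar>(-1) ^ n / real (Suc n)\<bar>"
    unfolding skew_harm_Suc by (rule abs_triangle_ineq)
  also have "\<bar>(-1) ^ n / real (Suc n)\<bar> \<le> 1"
    by (simp add: abs_divide power_abs)
  finally show ?case using Suc by simp
qed (simp add: skew_harm_def)

lemma harm_le_of_nat: "harm n \<le> real n"
proof (induction n)
  case (Suc n)
  have "inverse (real (Suc n)) \<le> 1"
    by (simp add: inverse_eq_divide)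
  with Suc show ?case by (simp add: harm_Suc)
qed (simp add: harm_expand)

section \<open>Termwise integration and Tonelli's theorem\<close>

text \<open>Nonnegativity makes the partial sums increasing, so monotone convergence applies without
  a dominating function.\<close>

lemma has_integral_sums_nonneg:
  fixes f :: "nat \<Rightarrow> 'a::euclidean_space \<Rightarrow> real"
  assumes "\<And>n. (f n has_integral a n) S" and "\<And>n x. x \<in> S \<Longrightarrow> f n x \<ge> 0"
    and "\<And>x. x \<in> S \<Longrightarrow> (\<lambda>n. f n x) sums g x" and "a sums A"
  shows "(g has_integral A) S"
proof (rule has_integral_monotone_convergence_increasing)
  show "((\<lambda>x. \<Sum>n<k. f n x) has_integral (\<Sum>n<k. a n)) S" for k
    by (intro has_integral_sum assms) auto
qed (use assms in \<open>auto simp: sums_def\<close>)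

text \<open>Integrability of \<open>g\<close> is a conclusion. Both iterated integrals are compared
  as extended nonnegative integrals, where the exchange needs only measurability, and finiteness
  comes from the known integral of \<open>h\<close>.\<close>

lemma has_integral_Tonelli:
  fixes f :: "real \<Rightarrow> real \<Rightarrow> real"
  assumes meas: "(\<lambda>p. f (fst p) (snd p)) \<in> borel_measurable (borel \<Otimes>\<^sub>M borel)"
    and AB: "A \<in> sets borel" "B \<in> sets borel"
    and nonneg: "\<And>x y. x \<in> A \<Longrightarrow> y \<in> B \<Longrightarrow> f x y \<ge> 0"
    and inner_g: "\<And>x. x \<in> A \<Longrightarrow> (f x has_integral g x) B"
    and inner_h: "\<And>y. y \<in> B \<Longrightarrow> ((\<lambda>x. f x y) has_integral h y) A"
    and h: "(h has_integral I) B"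
  shows "(g has_integral I) A"
proof -
  have h_nonneg: "h y \<ge> 0" if "y \<in> B" for y
    using has_integral_nonneg[OF inner_h[OF that]] nonneg that by auto
  have g_nonneg: "g x \<ge> 0" if "x \<in> A" for x
    using has_integral_nonneg[OF inner_g[OF that]] nonneg that by auto
  have I: "I \<ge> 0"
    using has_integral_nonneg[OF h] h_nonneg by auto
  define F where "F x y = ennreal (f x y) * indicator A x * indicator B y" for x y
  have "(\<lambda>(x, y). F x y) \<in> borel_measurable (borel \<Otimes>\<^sub>M borel)"
    using AB meas unfolding F_def case_prod_unfold by measurable
  then have F_meas: "(\<lambda>(x, y). F x y) \<in> borel_measurable (lborel \<Otimes>\<^sub>M lborel)"
    by (simp cong: sets_pair_measure_cong measurable_cong_sets)
  have F_g: "ennreal (g x * indicator A x) = (\<integral>\<^sup>+y. F x y \<partial>lborel)" for x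
  proof (cases "x \<in> A")
    case True
    then have "(\<integral>\<^sup>+y. ennreal (f x y) * indicator B y \<partial>lborel) = ennreal (g x)"
      by (intro nn_integral_has_integral_lebesgue' nonneg inner_g)
    with True show ?thesis by (simp add: F_def)
  qed (simp add: F_def)
  have F_h: "(\<integral>\<^sup>+x. F x y \<partial>lborel) = ennreal (h y) * indicator B y" for y
  proof (cases "y \<in> B")
    case True
    then have "(\<integral>\<^sup>+x. ennreal (f x y) * indicator A x \<partial>lborel) = ennreal (h y)"
      by (intro nn_integral_has_integral_lebesgue' nonneg inner_h)
    with True show ?thesis by (simp add: F_def)
  qed (simp add: F_def)
  \<comment> \<open>Measurability of \<open>g\<close> on \<open>A\<close> is inherited from the
    inner integral as a function of \<open>x\<close>. That integral is finite everywhere, so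
    \<open>enn2real\<close> loses nothing.\<close>
  have "(\<lambda>x. enn2real (\<integral>\<^sup>+y. F x y \<partial>lborel)) \<in> borel_measurable lborel"
    using lborel.borel_measurable_nn_integral[OF F_meas] by measurable
  moreover have "enn2real (\<integral>\<^sup>+y. F x y \<partial>lborel) = g x * indicator A x" for x
    unfolding F_g[symmetric] using g_nonneg by (simp add: indicator_def)
  ultimately have g_meas: "(\<lambda>x. g x * indicator A x) \<in> borel_measurable borel"
    by simp
  have "(\<integral>\<^sup>+x. ennreal (g x * indicator A x) \<partial>lborel) = (\<integral>\<^sup>+x. (\<integral>\<^sup>+y. F x y \<partial>lborel) \<partial>lborel)"
    by (simp only: F_g)
  also have "\<dots> = (\<integral>\<^sup>+y. (\<integral>\<^sup>+x. F x y \<partial>lborel) \<partial>lborel)"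
    using F_meas by (rule lborel_pair.Fubini'[symmetric])
  also have "\<dots> = (\<integral>\<^sup>+y. ennreal (h y) * indicator B y \<partial>lborel)"
    by (simp only: F_h)
  also have "\<dots> = ennreal I"
    by (rule nn_integral_has_integral_lebesgue'[OF h_nonneg h])
  finally have "((\<lambda>x. g x * indicator A x) has_integral I) UNIV"
    using g_nonneg g_meas I
    by (intro nn_integral_has_integral) (auto simp: indicator_def)
  moreover have "(\<lambda>x. g x * indicator A x) = (\<lambda>x. if x \<in> A then g x else 0)"
    by (auto simp: indicator_def)
  ultimately show ?thesis
    using has_integral_restrict_UNIV[of A g I] by simp
qed

section \<open>The digamma quotient and the value of M\<close>

text \<open>The series in \<open>Digamma_def\<close> at t + 1 has terms 1/n - 1/(n+t) = t / (n
  (n+t)). The resulting expansion evaluates M and also the inner integrals of both double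
  integrals.\<close>

lemma Digamma_quotient_sums:
  fixes t :: real
  assumes "t > 0"
  shows "(\<lambda>n. 1 / (real (n + 1) * (real (n + 1) + t))) sums ((Digamma (t + 1) + euler_mascheroni) / t)"
proof -
  have "(\<lambda>n. inverse (real (Suc n)) - inverse (t + 1 + real n)) sums (Digamma (t + 1) + euler_mascheroni)"
    using summable_sums[OF summable_Digamma[of "t + 1"]] assms by (simp add: Digamma_def)
  from sums_divide[OF this, of t]
  have "(\<lambda>n. (inverse (real (Suc n)) - inverse (t + 1 + real n)) / t)
      sums ((Digamma (t + 1) + euler_mascheroni) / t)" .
  moreover have "(inverse (real (Suc n)) - inverse (t + 1 + real n)) / t
      = 1 / (real (n + 1) * (real (n + 1) + t))" for n
  proof -
    have "real n + 1 > 0" "t + 1 + real n > 0" using assms by auto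
    then show ?thesis
      using assms by (simp add: divide_simps)
  qed
  ultimately show ?thesis by simp
qed

text \<open>The summand of (b), indexed from 0; its sum is the S of the overview.\<close>

definition log_term :: "nat \<Rightarrow> real" where
  "log_term n = 1 / real (n + 1) * ln (1 + 1 / real (n + 1))"

lemma summable_log_term: "summable log_term"
proof (rule summable_comparison_test')
  show "summable (\<lambda>m. (1 / real (m + 1)) ^ 2)"
    using zeta_sums[of 2] sums_summable by blast
  show "norm (log_term n) \<le> (1 / real (n + 1)) ^ 2" for n
  proof -
    have "1 / real (n + 1) * ln (1 + 1 / real (n + 1)) \<le> 1 / real (n + 1) * (1 / real (n + 1))"
      by (intro mult_left_mono ln_add_one_self_le_self) auto
    then show ?thesis
      by (simp add: log_term_def power2_eq_square)
  qed
qed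

text \<open>The interval is open because at t = 0 division by zero makes the quotient 0, while the
  series there sums to zeta(2). The endpoints form a null set and can be restored later.\<close>

lemma Digamma_quotient_has_integral:
  "((\<lambda>t::real. (Digamma (t + 1) + euler_mascheroni) / t) has_integral suminf log_term) {0<..<1}"
proof (rule has_integral_sums_nonneg)
  fix n :: nat
  have "((\<lambda>t. 1 / (real (n + 1) * (real (n + 1) + t))) has_integral
      ln (real (n + 1) + 1) / real (n + 1) - ln (real (n + 1) + 0) / real (n + 1)) {0..1}"
  proof (rule fundamental_theorem_of_calculus)
    fix t :: real assume "t \<in> {0..1}"
    then have "((\<lambda>t. ln (real (n + 1) + t) / real (n + 1)) has_field_derivative
        1 / (real (n + 1) + t) / real (n + 1)) (at t within {0..1})"
      by (auto intro!: derivative_eq_intros)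
    then have "((\<lambda>t. ln (real (n + 1) + t) / real (n + 1)) has_field_derivative
        1 / (real (n + 1) * (real (n + 1) + t))) (at t within {0..1})"
      by (simp only: divide_divide_eq_left mult.commute)
    then show "((\<lambda>t. ln (real (n + 1) + t) / real (n + 1)) has_vector_derivative
        1 / (real (n + 1) * (real (n + 1) + t))) (at t within {0..1})"
      by (simp add: has_real_derivative_iff_has_vector_derivative)
  qed simp
  moreover have "ln (real (n + 1) + 1) / real (n + 1) - ln (real (n + 1) + 0) / real (n + 1) = log_term n"
  proof -
    have "1 + 1 / real (n + 1) = (real (n + 1) + 1) / real (n + 1)"
      by (simp add: field_simps)
    then show ?thesis
      unfolding log_term_def by (simp add: ln_div diff_divide_distrib del: of_nat_Suc of_nat_add)
  qed
  ultimately show "((\<lambda>t. 1 / (real (n + 1) * (real (n + 1) + t))) has_integral log_term n) {0<..<1}"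
    by (simp add: has_integral_Icc_iff_Ioo)
qed (auto simp: Digamma_quotient_sums[simplified] summable_log_term summable_sums)

section \<open>The zeta series and the telescoping series, (a) and (c) to (g)\<close>

text \<open>This shifts the index down by one: series producing - ln (1 - q) at q = 1/(m+2) recover
  all of \<open>log_term\<close>, whereas those producing ln (1 + q) give only
  \<open>log_term (Suc m)\<close>.\<close>

lemma neg_ln_one_minus_inverse_of_nat:
  "- ln (1 - 1 / real (m + 2)) = ln (1 + 1 / real (m + 1))"
proof -
  have "1 + 1 / real (m + 1) = inverse (1 - 1 / real (m + 2))"
    by (simp add: field_simps)
  moreover have "1 - 1 / real (m + 2) > 0"
    by (simp add: field_simps)
  ultimately show ?thesis
    by (simp only: ln_inverse)
qed

text \<open>The missing \<open>log_term 0\<close> is ln 2, which explains the ln 2 in (g) and in the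
  proof of (a).\<close>

lemma log_term_Suc_sums: "(\<lambda>m. log_term (Suc m)) sums (suminf log_term - ln 2)"
  by (subst sums_Suc_iff) (simp add: summable_log_term summable_sums log_term_def)

lemma inverse_abs_less_1: "\<bar>1 / real (m + 2)\<bar> < 1"
  by (simp add: field_simps)

lemma alternating_zeta_series:
  "(\<lambda>n. (-1) ^ n * zeta (real (n + 2)) / real (n + 1)) sums suminf log_term"
proof -
  have "(\<lambda>n. (-1) ^ n * (zeta (real (n + 2)) - 1) / real (n + 1)) sums (suminf log_term - ln 2)"
  proof (rule sums_swap_inverse_powers[OF _ _ _ log_term_Suc_sums])
    fix m n :: nat
    define q where "q = 1 / real (m + 2)"
    show "\<bar>(-1) ^ n / real (n + 1)\<bar> \<le> 2 * real (n + 1)"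
      by (simp add: abs_divide power_abs divide_le_eq algebra_simps)
    have "(\<lambda>n. q * ((-1) ^ n * q ^ (n + 1) / real (n + 1))) sums (q * ln (1 + q))"
      unfolding q_def by (intro sums_mult ln_one_plus_sums inverse_abs_less_1)
    then show "(\<lambda>n. (-1) ^ n / real (n + 1) * (1 / real (m + 2)) ^ (n + 2)) sums log_term (Suc m)"
      unfolding log_term_def q_def by (simp add: mult_ac)
    have "(\<lambda>m. (-1) ^ n / real (n + 1) * (1 / real (m + 2)) ^ (n + 2)) sums
        ((-1) ^ n / real (n + 1) * (zeta (real (n + 2)) - 1))"
      by (intro sums_mult zeta_minus_1_sums) simp
    then show "(\<lambda>m. (-1) ^ n / real (n + 1) * (1 / real (m + 2)) ^ (n + 2)) sums
        ((-1) ^ n * (zeta (real (n + 2)) - 1) / real (n + 1))"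
      by simp
  qed
  \<comment> \<open>Restoring the base 1 to every zeta value adds the alternating harmonic series,
    whose sum ln 2 cancels the deficit.\<close>
  from sums_add[OF this alternating_harmonic_series_sums]
  have "(\<lambda>n. (-1) ^ n * (zeta (real (n + 2)) - 1) / real (n + 1) + (-1) ^ n / real (Suc n))
      sums suminf log_term" by simp
  moreover have "(-1) ^ n * (zeta (real (n + 2)) - 1) / real (n + 1) + (-1) ^ n / real (Suc n)
      = (-1) ^ n * zeta (real (n + 2)) / real (n + 1)" for n
    by (simp add: algebra_simps diff_divide_distrib)
  ultimately show ?thesis by (simp only:)
qed

text \<open>Summation by parts: the summands differ from \<open>log_term\<close> by the telescoping
  differences of ln n / n, which starts at ln 1 = 0 and tends to 0.\<close>

lemma log_telescope_series:
  "(\<lambda>n. ln (real (n + 2)) / (real (n + 1) * real (n + 2))) sums suminf log_term"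
proof -
  have "(\<lambda>n. ln (real (n + 1)) / real (n + 1)) \<longlonglongrightarrow> 0"
    using LIMSEQ_Suc[OF lim_ln_over_n] by simp
  from sums_add[OF summable_sums[OF summable_log_term] telescope_sums'[OF this]]
  have "(\<lambda>n. log_term n + (ln (real (n + 1)) / real (n + 1) - ln (real (Suc n + 1)) / real (Suc n + 1)))
      sums suminf log_term" by simp
  moreover have "log_term n + (ln (real (n + 1)) / real (n + 1) - ln (real (Suc n + 1)) / real (Suc n + 1))
      = ln (real (n + 2)) / (real (n + 1) * real (n + 2))" for n
  proof -
    have "1 + 1 / real (n + 1) = real (n + 2) / real (n + 1)"
      by (simp add: field_simps)
    then have *: "log_term n = (ln (real (n + 2)) - ln (real (n + 1))) / real (n + 1)"
      unfolding log_term_def by (simp add: ln_div del: of_nat_Suc of_nat_add)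
    show ?thesis
      unfolding * by (simp add: divide_simps) (simp add: algebra_simps)
  qed
  ultimately show ?thesis by (simp only:)
qed

text \<open>With q = 1/(m+2), the generating function contributes - q ln (1 - q) / (1 - q). Since q
  / (1 - q) = 1/(m+1), this is exactly \<open>log_term m\<close>.\<close>

lemma harm_zeta_series:
  "(\<lambda>n. harm (n + 1) * (zeta (real (n + 2)) - 1)) sums suminf log_term"
proof (rule sums_swap_inverse_powers[OF _ _ _ summable_sums[OF summable_log_term]])
  fix m n :: nat
  define q where "q = 1 / real (m + 2)"
  have "\<bar>harm (n + 1)\<bar> \<le> real (n + 1)"
    unfolding abs_of_nonneg[OF harm_nonneg] by (rule harm_le_of_nat)
  also have "\<dots> \<le> 2 * real (n + 1)"
    by simp
  finally show "\<bar>harm (n + 1)\<bar> \<le> 2 * real (n + 1)" .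
  have "(\<lambda>n. q * (harm (n + 1) * q ^ (n + 1))) sums (q * (- ln (1 - q) / (1 - q)))"
    unfolding q_def by (intro sums_mult harm_generating_function inverse_abs_less_1)
  moreover have "q * (- ln (1 - q) / (1 - q)) = q / (1 - q) * - ln (1 - q)"
    by simp
  moreover have "q / (1 - q) = 1 / real (m + 1)"
    unfolding q_def by (simp add: divide_simps)
  ultimately show "(\<lambda>n. harm (n + 1) * (1 / real (m + 2)) ^ (n + 2)) sums log_term m"
    unfolding log_term_def q_def neg_ln_one_minus_inverse_of_nat by (simp add: mult_ac)
  show "(\<lambda>m. harm (n + 1) * (1 / real (m + 2)) ^ (n + 2)) sums
      (harm (n + 1) * (zeta (real (n + 2)) - 1))"
    by (intro sums_mult zeta_minus_1_sums) simp
qed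

text \<open>The terms are successive decrements of H_n - ln n, which falls from 1 at n = 1 to
  Euler's constant.\<close>

lemma log_minus_inverse_sums:
  "(\<lambda>m. ln (1 + 1 / real (m + 1)) - 1 / real (m + 2)) sums (1 - euler_mascheroni)"
proof -
  define d where "d n = harm (n + 1) - ln (real (n + 1))" for n
  have "d \<longlonglongrightarrow> euler_mascheroni"
    unfolding d_def using LIMSEQ_Suc[OF euler_mascheroni_LIMSEQ] by simp
  from telescope_sums'[OF this] have "(\<lambda>n. d n - d (Suc n)) sums (1 - euler_mascheroni)"
    by (simp add: d_def harm_expand)
  moreover have "d m - d (Suc m) = ln (1 + 1 / real (m + 1)) - 1 / real (m + 2)" for m
  proof -
    have "1 + 1 / real (m + 1) = real (m + 2) / real (m + 1)"
      by (simp add: field_simps)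
    then have "ln (1 + 1 / real (m + 1)) = ln (real (m + 2)) - ln (real (m + 1))"
      by (simp add: ln_div del: of_nat_Suc of_nat_add)
    then show ?thesis
      by (simp add: d_def harm_Suc inverse_eq_divide)
  qed
  ultimately show ?thesis by simp
qed

text \<open>This is the gap between (d) and (e), because consecutive harmonic numbers differ by
  1/(n+2). The sum over exponents is the logarithm series without its first term, - ln (1 - q) -
  q.\<close>

lemma zeta_quotient_series:
  "(\<lambda>n. (zeta (real (n + 2)) - 1) / real (n + 2)) sums (1 - euler_mascheroni)"
proof (rule sums_swap_inverse_powers[OF _ _ _ log_minus_inverse_sums])
  fix m n :: nat
  define q where "q = 1 / real (m + 2)"
  show "\<bar>1 / real (n + 2)\<bar> \<le> 2 * real (n + 1)"
    by (simp add: divide_le_eq algebra_simps)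
  have "(\<lambda>n. q ^ (n + 1) / real (n + 1)) sums - ln (1 - q)"
    unfolding q_def by (intro neg_ln_one_minus_sums inverse_abs_less_1)
  then have "(\<lambda>n. q ^ (Suc n + 1) / real (Suc n + 1)) sums (- ln (1 - q) - q)"
    by (subst sums_Suc_iff) simp
  then show "(\<lambda>n. 1 / real (n + 2) * (1 / real (m + 2)) ^ (n + 2)) sums
      (ln (1 + 1 / real (m + 1)) - 1 / real (m + 2))"
    unfolding q_def neg_ln_one_minus_inverse_of_nat by (simp add: mult_ac)
  have "(\<lambda>m. 1 / real (n + 2) * (1 / real (m + 2)) ^ (n + 2)) sums
      (1 / real (n + 2) * (zeta (real (n + 2)) - 1))"
    by (intro sums_mult zeta_minus_1_sums) simp
  then show "(\<lambda>m. 1 / real (n + 2) * (1 / real (m + 2)) ^ (n + 2)) sums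
      ((zeta (real (n + 2)) - 1) / real (n + 2))"
    by simp
qed

lemma harm_zeta_shifted_series:
  "(\<lambda>n. harm (n + 2) * (zeta (real (n + 2)) - 1)) sums (suminf log_term + 1 - euler_mascheroni)"
proof -
  have "harm (n + 1) * (zeta (real (n + 2)) - 1) + (zeta (real (n + 2)) - 1) / real (n + 2)
      = harm (n + 2) * (zeta (real (n + 2)) - 1)" for n
    by (simp add: harm_Suc inverse_eq_divide add_ac) (simp add: algebra_simps diff_divide_distrib)
  then show ?thesis
    using sums_add[OF harm_zeta_series zeta_quotient_series] by (simp only: add_diff_eq)
qed

text \<open>The base case telescopes to 1. With q = 1/(m+2), the identity 1/(m+1) - q = q/(m+1)
  shows that raising the exponent by one subtracts q^(n+2) from each term, hence zeta(n+2) - 1 from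
  the sum.\<close>

lemma zeta_tail_sums:
  "(\<lambda>m. (1 / real (m + 2)) ^ (n + 1) / real (m + 1)) sums
     (real (n + 1) - (\<Sum>k=2..n+1. zeta (real k)))"
proof (induction n)
  case 0
  have "(\<lambda>m. 1 / real (m + 1) - 1 / real (Suc m + 1)) sums (1 / real (0 + 1) - 0)"
    using LIMSEQ_Suc[OF lim_1_over_n] by (intro telescope_sums') simp
  moreover have "1 / real (m + 1) - 1 / real (Suc m + 1) = (1 / real (m + 2)) ^ 1 / real (m + 1)" for m
    by (simp add: divide_simps)
  ultimately show ?case by simp
next
  case (Suc n)
  have "(\<lambda>m. (1 / real (m + 2)) ^ (n + 1) / real (m + 1) - (1 / real (m + 2)) ^ (n + 2)) sums
      (real (n + 1) - (\<Sum>k=2..n+1. zeta (real k)) - (zeta (real (n + 2)) - 1))"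
    by (intro sums_diff Suc zeta_minus_1_sums) simp
  moreover have "(1 / real (m + 2)) ^ (n + 1) / real (m + 1) - (1 / real (m + 2)) ^ (n + 2)
      = (1 / real (m + 2)) ^ (Suc n + 1) / real (m + 1)" for m
  proof -
    define q where "q = 1 / real (m + 2)"
    have "1 / real (m + 1) - q = q / real (m + 1)"
      unfolding q_def by (simp add: divide_simps)
    then have "q ^ (n + 1) * (1 / real (m + 1) - q) = q ^ (n + 1) * (q / real (m + 1))"
      by simp
    then show ?thesis
      unfolding q_def[symmetric] by (simp add: algebra_simps)
  qed
  moreover have "(\<Sum>k=2..Suc n+1. zeta (real k)) = (\<Sum>k=2..n+1. zeta (real k)) + zeta (real (n + 2))"
    by simp
  ultimately show ?case by (simp add: algebra_simps)
qed

lemma zeta_tail_series: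
  "(\<lambda>n. 1 / real (n + 1) * (real (n + 1) - (\<Sum>k=2..n+1. zeta (real k)))) sums suminf log_term"
proof (rule sums_swap_inverse_powers[OF _ _ _ summable_sums[OF summable_log_term]])
  fix m n :: nat
  define q where "q = 1 / real (m + 2)"
  \<comment> \<open>The factor (m+2)/(m+1) turns q^(n+2) into q^(n+1) / (m+1). It is at most 2,
    which accounts for the constant 2 in \<open>sums_swap_inverse_powers\<close>.\<close>
  let ?c = "\<lambda>m n. 1 / real (n + 1) * (real (m + 2) / real (m + 1))"
  have "1 / real (n + 1) * (real (m + 2) / real (m + 1)) \<le> 1 * 2"
    by (intro mult_mono) (auto simp: divide_simps)
  then show "\<bar>?c m n\<bar> \<le> 2 * real (n + 1)"
    by (simp add: abs_mult)
  have c: "?c m n * (1 / real (m + 2)) ^ (n + 2) =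
      1 / real (n + 1) * ((1 / real (m + 2)) ^ (n + 1) / real (m + 1))" for m n
    by (simp add: divide_simps)
  have "(\<lambda>n. 1 / real (m + 1) * (q ^ (n + 1) / real (n + 1))) sums (1 / real (m + 1) * - ln (1 - q))"
    unfolding q_def by (intro sums_mult neg_ln_one_minus_sums inverse_abs_less_1)
  then show "(\<lambda>n. ?c m n * (1 / real (m + 2)) ^ (n + 2)) sums log_term m"
    unfolding log_term_def q_def neg_ln_one_minus_inverse_of_nat c by (simp add: mult_ac)
  show "(\<lambda>m. ?c m n * (1 / real (m + 2)) ^ (n + 2)) sums
      (1 / real (n + 1) * (real (n + 1) - (\<Sum>k=2..n+1. zeta (real k))))"
    unfolding c by (intro sums_mult zeta_tail_sums)
qed

text \<open>Differences of consecutive zeta values cancel the base 1 and contribute a factor 1 - q.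
  That factor removes the denominator of the generating function and leaves q ln (1 + q).\<close>

lemma skew_harm_zeta_series:
  "(\<lambda>n. skew_harm (n + 1) * (zeta (real (n + 2)) - zeta (real (n + 3)))) sums (suminf log_term - ln 2)"
proof (rule sums_swap_inverse_powers[OF _ _ _ log_term_Suc_sums])
  fix m n :: nat
  define q where "q = 1 / real (m + 2)"
  have q: "0 \<le> q" "q < 1"
    using inverse_abs_less_1[of m] by (auto simp: q_def)
  have "\<bar>skew_harm (n + 1)\<bar> * \<bar>1 - q\<bar> \<le> real (n + 1) * 1"
    using q by (intro mult_mono abs_skew_harm_le) auto
  also have "\<dots> \<le> 2 * real (n + 1)"
    by simp
  finally show "\<bar>skew_harm (n + 1) * (1 - 1 / real (m + 2))\<bar> \<le> 2 * real (n + 1)"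
    by (simp add: abs_mult q_def)
  have "(\<lambda>n. q * (1 - q) * (skew_harm (n + 1) * q ^ (n + 1))) sums (q * (1 - q) * (ln (1 + q) / (1 - q)))"
    unfolding q_def by (intro sums_mult skew_harm_generating_function inverse_abs_less_1)
  moreover have "q * (1 - q) * (ln (1 + q) / (1 - q)) = log_term (Suc m)"
    using q by (simp add: log_term_def q_def)
  ultimately show "(\<lambda>n. skew_harm (n + 1) * (1 - 1 / real (m + 2)) * (1 / real (m + 2)) ^ (n + 2)) sums log_term (Suc m)"
    unfolding q_def[symmetric] by (simp add: mult_ac)
  have "(\<lambda>m. skew_harm (n + 1) * ((1 / real (m + 2)) ^ (n + 2) - (1 / real (m + 2)) ^ (n + 3))) sums
      (skew_harm (n + 1) * ((zeta (real (n + 2)) - 1) - (zeta (real (n + 3)) - 1)))"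
    by (intro sums_mult sums_diff zeta_minus_1_sums) simp_all
  moreover have "skew_harm (n + 1) * ((1 / real (m + 2)) ^ (n + 2) - (1 / real (m + 2)) ^ (n + 3))
      = skew_harm (n + 1) * (1 - 1 / real (m + 2)) * (1 / real (m + 2)) ^ (n + 2)" for m
    unfolding numeral_3_eq_3 add_Suc_right by (simp only: right_diff_distrib left_diff_distrib
        power_Suc numeral_2_eq_2 add_Suc_right mult_1_right mult_1_left mult_ac)
  ultimately show "(\<lambda>m. skew_harm (n + 1) * (1 - 1 / real (m + 2)) * (1 / real (m + 2)) ^ (n + 2)) sums
      (skew_harm (n + 1) * (zeta (real (n + 2)) - zeta (real (n + 3))))"
    by simp
qed

section \<open>The binomial series (j)\<close>

text \<open>The extra factor x raises every exponent to at least 2, so summing over x = 1/m yields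
  the finite combination of zeta values in (j).\<close>

lemma binomial_complement_expansion:
  fixes x :: real
  shows "x * (1 - (1 - x) ^ n) = (\<Sum>k=1..n. real (n choose k) * (-1) ^ (k - 1) * x ^ (k + 1))"
proof -
  have "(1 - x) ^ n = (\<Sum>k\<le>n. real (n choose k) * (- x) ^ k)"
    using binomial_ring[of "- x" 1 n] by simp
  also have "\<dots> = 1 + (\<Sum>k=1..n. real (n choose k) * (- x) ^ k)"
    by (simp add: atMost_atLeast0 sum.atLeast_Suc_atMost)
  finally have "x * (1 - (1 - x) ^ n) = (\<Sum>k=1..n. - x * (real (n choose k) * (- x) ^ k))"
    by (simp add: sum_distrib_left sum_negf)
  also have "\<dots> = (\<Sum>k=1..n. real (n choose k) * (-1) ^ (k - 1) * x ^ (k + 1))"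
  proof (rule sum.cong)
    fix k assume "k \<in> {1..n}"
    then obtain j where "k = Suc j"
      by (cases k) auto
    then show "- x * (real (n choose k) * (- x) ^ k) = real (n choose k) * (-1) ^ (k - 1) * x ^ (k + 1)"
      by (simp add: power_minus[of x] mult_ac)
  qed simp
  finally show ?thesis .
qed

text \<open>Here the weight 2^-n supplies the decay, so the base 1 can stay and the general
  interchange lemma is used. Bernoulli's inequality gives a second factor x, and its n + 1 cancels
  the denominator.\<close>

lemma binomial_zeta_series:
  "(\<lambda>n. 1 / (real (n + 1) * 2 ^ (n + 1)) *
      (\<Sum>k=1..n+1. real ((n + 1) choose k) * (-1) ^ (k - 1) * zeta (real (k + 1)))) sums suminf log_term"
proof (rule sums_swap_dominated)
  define f where
    "f m n = 1 / (real (n + 1) * 2 ^ (n + 1)) *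
      (1 / real (m + 1) * (1 - (1 - 1 / real (m + 1)) ^ (n + 1)))" for m n
  show "summable (\<lambda>m. (1 / real (m + 1)) ^ 2)"
    using zeta_sums[of 2] sums_summable by blast
  show "summable (\<lambda>n. (1 / 2 :: real) ^ (n + 1))"
    using summable_geometric[of "1 / 2 :: real"] by simp
  fix m n :: nat
  define x where "x = 1 / real (m + 1)"
  have x: "0 < x" "x \<le> 1"
    by (auto simp: x_def)
  have f_x: "f m n = 1 / (real (n + 1) * 2 ^ (n + 1)) * (x * (1 - (1 - x) ^ (n + 1)))" for n
    by (simp add: f_def x_def)
  have bernoulli: "1 - (1 - x) ^ (n + 1) \<le> real (n + 1) * x"
    using Bernoulli_inequality[of "- x" "n + 1"] x by simp
  have "0 \<le> f m n"
    unfolding f_x using x power_le_one[of "1 - x" "n + 1"] by (intro mult_nonneg_nonneg) auto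
  moreover have "f m n \<le> 1 / (real (n + 1) * 2 ^ (n + 1)) * (x * (real (n + 1) * x))"
    unfolding f_x using x bernoulli by (intro mult_left_mono) auto
  moreover have "1 / (real (n + 1) * 2 ^ (n + 1)) * (x * (real (n + 1) * x)) = x ^ 2 * (1 / 2) ^ (n + 1)"
    by (simp add: power_divide power2_eq_square divide_simps)
  ultimately show "\<bar>f m n\<bar> \<le> (1 / real (m + 1)) ^ 2 * (1 / 2) ^ (n + 1)"
    unfolding x_def[symmetric] by linarith
  \<comment> \<open>The row splits into logarithm series at 1/2 and (1 - x)/2; their ln 2 terms
    cancel, leaving x ln (1 + x).\<close>
  have "(\<lambda>n. x * ((1 / 2) ^ (n + 1) / real (n + 1) - ((1 - x) / 2) ^ (n + 1) / real (n + 1))) sums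
      (x * (- ln (1 - 1 / 2) - (- ln (1 - (1 - x) / 2))))"
    using x by (intro sums_mult sums_diff neg_ln_one_minus_sums) auto
  moreover have "x * ((1 / 2) ^ (n + 1) / real (n + 1) - ((1 - x) / 2) ^ (n + 1) / real (n + 1)) = f m n" for n
    unfolding f_x power_divide by (simp add: divide_simps)
  moreover have "- ln (1 - 1 / 2) - (- ln (1 - (1 - x) / 2)) = ln (1 + x)"
  proof -
    have *: "1 - (1 - x) / 2 = (1 + x) / 2"
      by (simp add: field_simps)
    show ?thesis
      unfolding * using x by (simp add: ln_div)
  qed
  ultimately show "f m sums log_term m"
    by (simp add: log_term_def x_def)
  show "(\<lambda>m. f m n) sums (1 / (real (n + 1) * 2 ^ (n + 1)) *
      (\<Sum>k=1..n+1. real ((n + 1) choose k) * (-1) ^ (k - 1) * zeta (real (k + 1))))"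
    unfolding f_def binomial_complement_expansion
    by (intro sums_mult sums_sum zeta_sums) auto
qed (auto intro: summable_sums summable_log_term)

section \<open>The modified exponential integral and (h)\<close>

(* The multiplied form y * D avoids a case distinction at the removable singularity y = 0. *)
lemma Ein_has_field_derivative:
  "\<exists>D. (Ein has_field_derivative D) (at y) \<and> y * D = 1 - exp (- y)"
proof -
  \<comment> \<open>\<open>Ein\<close> has no constant term; padding with c 0 = 0 gives an ordinary
    power series that can be differentiated termwise.\<close>
  define c :: "nat \<Rightarrow> real" where
    "c n = (if n = 0 then 0 else (-1) ^ (n - 1) / (fact n * real n))" for n
  have summable_c: "summable (\<lambda>n. c n * z ^ n)" for z
  proof (rule summable_comparison_test')
    show "summable (\<lambda>n. inverse (fact n) * \<bar>z\<bar> ^ n)"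
      by (rule summable_exp)
    fix n :: nat
    have "\<bar>c n\<bar> \<le> inverse (fact n)"
      by (auto simp: c_def abs_mult power_abs divide_simps)
    then show "norm (c n * z ^ n) \<le> inverse (fact n) * \<bar>z\<bar> ^ n"
      by (auto simp: abs_mult power_abs intro!: mult_right_mono)
  qed
  have "Ein z = (\<Sum>n. c n * z ^ n)" for z
    using suminf_split_head[OF summable_c, of z] by (simp add: Ein_def c_def)
  then have "Ein = (\<lambda>z. \<Sum>n. c n * z ^ n)"
    by blast
  with termdiffs_strong_converges_everywhere[OF summable_c, of y]
  have deriv: "(Ein has_field_derivative (\<Sum>n. diffs c n * y ^ n)) (at y)"
    by simp
  have "(\<lambda>n. (- y) ^ n /\<^sub>R fact n) sums exp (- y)"
    by (rule exp_converges)
  then have "(\<lambda>n. (- y) ^ Suc n /\<^sub>R fact (Suc n)) sums (exp (- y) - 1)"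
    by (subst sums_Suc_iff) simp
  from sums_minus[OF this]
  have exp_sums: "(\<lambda>n. - ((- y) ^ Suc n /\<^sub>R fact (Suc n))) sums (1 - exp (- y))"
    by simp
  have "summable (\<lambda>n. diffs c n * y ^ n)"
    by (rule termdiff_converges_all) (rule summable_c)
  then have "(\<lambda>n. y * (diffs c n * y ^ n)) sums (y * (\<Sum>n. diffs c n * y ^ n))"
    by (intro sums_mult summable_sums)
  moreover have "y * (diffs c n * y ^ n) = - ((- y) ^ Suc n /\<^sub>R fact (Suc n))" for n
    by (simp add: diffs_def c_def power_minus[of y] divide_simps del: fact_Suc)
  ultimately have "y * (\<Sum>n. diffs c n * y ^ n) = 1 - exp (- y)"
    using exp_sums sums_unique2 by (metis (no_types, lifting) sums_cong)
  with deriv show ?thesis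
    by blast
qed

text \<open>The antiderivative is Ein (x t). At t = 0 its derivative is x while the integrand is 0
  by the division convention, so the fundamental theorem is used in its interior form.\<close>

lemma Ein_has_integral:
  "((\<lambda>t. (1 - exp (- (x * t))) / t) has_integral Ein x) {0<..<1}"
proof -
  have "((\<lambda>t. (1 - exp (- (x * t))) / t) has_integral (Ein (x * 1) - Ein (x * 0))) {0..1}"
  proof (rule fundamental_theorem_of_calculus_interior)
    have "isCont Ein y" for y
      using Ein_has_field_derivative DERIV_isCont by blast
    then have "continuous_on UNIV Ein"
      by (simp add: continuous_on_eq_continuous_at)
    then show "continuous_on {0..1} (\<lambda>t. Ein (x * t))"
      by (rule continuous_on_compose2) (auto intro!: continuous_intros)
  next
    fix t :: real assume t: "t \<in> {0<..<1}"
    obtain D where D: "(Ein has_field_derivative D) (at (x * t))" "x * t * D = 1 - exp (- (x * t))"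
      using Ein_has_field_derivative by blast
    have "((\<lambda>t. Ein (x * t)) has_field_derivative D * x) (at t)"
      by (rule DERIV_chain2[where g = "\<lambda>t. x * t", OF D(1)]) (auto intro!: derivative_eq_intros)
    moreover have "D * x = (1 - exp (- (x * t))) / t"
      using t unfolding D(2)[symmetric] by simp
    ultimately show "((\<lambda>t. Ein (x * t)) has_vector_derivative (1 - exp (- (x * t))) / t) (at t)"
      by (simp add: has_real_derivative_iff_has_vector_derivative)
  qed simp
  then show ?thesis
    by (simp add: has_integral_Icc_iff_Ioo Ein_def)
qed

lemma Ein_quotient_has_integral:
  "((\<lambda>x. Ein x / (exp x - 1)) has_integral suminf log_term) {0..}"
proof (rule has_integral_Tonelli[OF _ _ _ _ _ _ Digamma_quotient_has_integral])
  define f :: "real \<Rightarrow> real \<Rightarrow> real" where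
    "f x t = (1 - exp (- (x * t))) / t / (exp x - 1)" for x t
  show "(\<lambda>p. f (fst p) (snd p)) \<in> borel_measurable (borel \<Otimes>\<^sub>M borel)"
    unfolding f_def by measurable
  show "(f x has_integral Ein x / (exp x - 1)) {0<..<1}" for x
    unfolding f_def by (intro has_integral_divide Ein_has_integral)
  show "f x t \<ge> 0" if "x \<in> {0..}" "t \<in> {0<..<1}" for x t
    unfolding f_def using that by (intro divide_nonneg_nonneg) auto
  fix t :: real assume t: "t \<in> {0<..<1}"
  \<comment> \<open>Terms of \<open>f\<close> after expanding 1 / (e^x - 1) into powers of e^-x;
    each integrates to (1/(n+1) - 1/(n+1+t)) / t.\<close>
  define g where "g n x = (1 - exp (- (x * t))) / t * exp (- (real (n + 1) * x))" for n x
  show "((\<lambda>x. f x t) has_integral (Digamma (t + 1) + euler_mascheroni) / t) {0..}"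
  proof (rule has_integral_sums_nonneg)
    fix n :: nat
    have "((\<lambda>x. (exp (- real (n + 1) * x) - exp (- (real (n + 1) + t) * x)) / t) has_integral
        (exp (- real (n + 1) * 0) / real (n + 1) -
         exp (- (real (n + 1) + t) * 0) / (real (n + 1) + t)) / t) {0..}"
      using t by (intro has_integral_divide has_integral_diff has_integral_exp_minus_to_infinity) auto
    moreover have "(exp (- real (n + 1) * x) - exp (- (real (n + 1) + t) * x)) / t = g n x" for x
      by (simp add: g_def algebra_simps exp_diff exp_minus exp_add divide_simps)
    moreover have "(exp (- real (n + 1) * 0) / real (n + 1) -
         exp (- (real (n + 1) + t) * 0) / (real (n + 1) + t)) / t = 1 / (real (n + 1) * (real (n + 1) + t))"
    proof -
      have "real (n + 1) > 0" "real (n + 1) + t > 0" "t > 0"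
        using t by auto
      then show ?thesis
        by (simp add: divide_simps del: of_nat_add of_nat_Suc)
    qed
    ultimately show "(g n has_integral 1 / (real (n + 1) * (real (n + 1) + t))) {0..}"
      by simp
    show "g n x \<ge> 0" if "x \<in> {0..}" for x
      unfolding g_def using that t by (intro mult_nonneg_nonneg divide_nonneg_nonneg) auto
  next
    fix x :: real assume x: "x \<in> {0..}"
    show "(\<lambda>n. g n x) sums f x t"
    \<comment> \<open>At x = 0 the geometric series diverges, but the factor 1 - e^(-xt) kills every
      term, and \<open>f 0 t\<close> is 0 as well.\<close>
    proof (cases "x = 0")
      case False
      with x have "(\<lambda>n. exp (- x) ^ n) sums (1 / (1 - exp (- x)))"
        by (intro geometric_sums) auto
      then have "(\<lambda>n. (1 - exp (- (x * t))) / t * exp (- x) * exp (- x) ^ n) sums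
          ((1 - exp (- (x * t))) / t * exp (- x) * (1 / (1 - exp (- x))))"
        by (rule sums_mult)
      moreover have "(1 - exp (- (x * t))) / t * exp (- x) * exp (- x) ^ n = g n x" for n
        by (simp add: g_def exp_of_nat_mult[symmetric] algebra_simps flip: exp_add)
      moreover have "exp (- x) * (1 / (1 - exp (- x))) = 1 / (exp x - 1)"
        using False x by (simp add: exp_minus divide_simps)
      moreover from this have "(1 - exp (- (x * t))) / t * exp (- x) * (1 / (1 - exp (- x))) = f x t"
        by (simp only: f_def mult.assoc) simp
      ultimately show ?thesis
        by (simp only:)
    qed (simp add: g_def f_def)
  qed (use t in \<open>auto intro: Digamma_quotient_sums[simplified]\<close>)
qed auto

section \<open>The logarithmic integral (i)\<close>

text \<open>Integrating u^(t-1) over t produces the 1 / ln u. For fixed t, expanding - ln (1 - u)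
  instead leaves the power integrals of u^(n+t), equal to 1 / (n+1+t).\<close>

lemma log_quotient_has_integral:
  "((\<lambda>u. (1 - u) * ln (1 - u) / (u * ln u)) has_integral suminf log_term) {0<..<1}"
proof (rule has_integral_Tonelli[OF _ _ _ _ _ _ Digamma_quotient_has_integral])
  define f :: "real \<Rightarrow> real \<Rightarrow> real" where
    "f u t = u powr (t - 1) * - ln (1 - u)" for u t
  show "(\<lambda>p. f (fst p) (snd p)) \<in> borel_measurable (borel \<Otimes>\<^sub>M borel)"
    unfolding f_def by measurable
  show "f u t \<ge> 0" if "u \<in> {0<..<1}" "t \<in> {0<..<1}" for u t
    unfolding f_def using that by (intro mult_nonneg_nonneg) auto
  show "(f u has_integral (1 - u) * ln (1 - u) / (u * ln u)) {0<..<1}" if u: "u \<in> {0<..<1}" for u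
  proof -
    have "((\<lambda>t. u powr (t - 1)) has_integral u powr (1 - 1) / ln u - u powr (0 - 1) / ln u) {0..1}"
    proof (rule fundamental_theorem_of_calculus)
      fix t :: real
      have "((\<lambda>t. exp ((t - 1) * ln u) / ln u) has_field_derivative exp ((t - 1) * ln u)) (at t within {0..1})"
        using u by (auto intro!: derivative_eq_intros)
      then have "((\<lambda>t. u powr (t - 1) / ln u) has_field_derivative u powr (t - 1)) (at t within {0..1})"
        using u by (simp add: powr_def)
      then show "((\<lambda>t. u powr (t - 1) / ln u) has_vector_derivative u powr (t - 1)) (at t within {0..1})"
        by (simp add: has_real_derivative_iff_has_vector_derivative)
    qed simp
    then have "(f u has_integral
        (u powr (1 - 1) / ln u - u powr (0 - 1) / ln u) * - ln (1 - u)) {0<..<1}"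
      unfolding f_def has_integral_Icc_iff_Ioo by (rule has_integral_mult_left)
    moreover have "(u powr (1 - 1) / ln u - u powr (0 - 1) / ln u) * - ln (1 - u)
        = (1 - u) * ln (1 - u) / (u * ln u)"
      using u by (simp add: powr_minus divide_simps) (simp add: algebra_simps)
    ultimately show ?thesis by simp
  qed
  fix t :: real assume t: "t \<in> {0<..<1}"
  show "((\<lambda>u. f u t) has_integral (Digamma (t + 1) + euler_mascheroni) / t) {0<..<1}"
  proof (rule has_integral_sums_nonneg)
    fix n :: nat
    have "((\<lambda>u. u powr (real n + t)) has_integral 1 powr (real n + t + 1) / (real n + t + 1)) {0..1}"
      using t by (intro has_integral_powr_from_0) auto
    then have "((\<lambda>u. 1 / real (n + 1) * u powr (real n + t)) has_integral
        1 / real (n + 1) * (1 powr (real n + t + 1) / (real n + t + 1))) {0<..<1}"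
      unfolding has_integral_Icc_iff_Ioo by (rule has_integral_mult_right)
    then show "((\<lambda>u. 1 / real (n + 1) * u powr (real n + t)) has_integral
        1 / (real (n + 1) * (real (n + 1) + t))) {0<..<1}"
      by (simp add: add_ac)
  next
    fix u :: real assume u: "u \<in> {0<..<1}"
    have "(\<lambda>n. u powr (t - 1) * (u ^ (n + 1) / real (n + 1))) sums f u t"
      unfolding f_def using u by (intro sums_mult neg_ln_one_minus_sums) auto
    moreover have "u powr (t - 1) * (u ^ (n + 1) / real (n + 1)) = 1 / real (n + 1) * u powr (real n + t)" for n
    proof -
      have "u powr (t - 1) * u ^ (n + 1) = u powr (t - 1) * u powr real (n + 1)"
        using u by (simp only: powr_realpow greaterThanLessThan_iff)
      also have "\<dots> = u powr (real n + t)"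
        unfolding powr_add[symmetric] by (simp add: add_ac)
      finally show ?thesis by simp
    qed
    ultimately show "(\<lambda>n. 1 / real (n + 1) * u powr (real n + t)) sums f u t"
      by simp
  qed (use t in \<open>auto intro: Digamma_quotient_sums[simplified]\<close>)
qed auto

theorem theorem1:
  fixes M :: real
  assumes M_def: "M = integral {0..1} (\<lambda>t::real. (Digamma (t + 1) + euler_mascheroni) / t)"
  shows
    "(\<lambda>t::real. (Digamma (t + 1) + euler_mascheroni) / t) integrable_on {0..1} \<and>
     sums_from 1 (\<lambda>n. (-1) ^ (n - 1) * zeta (real (n + 1)) / real n) M \<and>
     sums_from 1 (\<lambda>n. 1 / real n * ln (1 + 1 / real n)) M \<and>
     sums_from 1 (\<lambda>n. ln (real (n + 1)) / (real n * real (n + 1))) M \<and>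
     sums_from 1 (\<lambda>n. harm n * (zeta (real (n + 1)) - 1)) M \<and>
     sums_from 2 (\<lambda>n. harm n * (zeta (real n) - 1)) (M + 1 - euler_mascheroni) \<and>
     sums_from 1 (\<lambda>n. 1 / real n * (real n - (\<Sum>k=2..n. zeta (real k)))) M \<and>
     sums_from 1 (\<lambda>n. skew_harm n * (zeta (real (n + 1)) - zeta (real (n + 2)))) (M - ln 2) \<and>
     ((\<lambda>x. Ein x / (exp x - 1)) has_integral M) {0..} \<and>
     ((\<lambda>u. (1 - u) * ln (1 - u) / (u * ln u)) has_integral M) {0..1} \<and>
     sums_from 1 (\<lambda>n. 1 / (real n * 2 ^ n) *
       (\<Sum>k=1..n. real (n choose k) * (-1) ^ (k - 1) * zeta (real (k + 1)))) M"
proof -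
  have int: "((\<lambda>t::real. (Digamma (t + 1) + euler_mascheroni) / t) has_integral suminf log_term) {0..1}"
    using Digamma_quotient_has_integral by (simp only: has_integral_Icc_iff_Ioo)
  then have M: "M = suminf log_term"
    unfolding M_def by (rule integral_unique)
  \<comment> \<open>Unfolding \<open>sums_from\<close> puts n + 1 or n + 2 for the index; these
    equations, including the truncated subtraction, bring the arguments into the form of the
    lemmas.\<close>
  have shift: "n + 1 + 1 = n + 2" "n + 1 + 2 = n + 3" "n + 1 - 1 = n" for n :: nat
    by auto
  show ?thesis
    unfolding sums_from_def M shift
  proof (intro conjI)
    show "(\<lambda>n. 1 / real (n + 1) * ln (1 + 1 / real (n + 1))) sums suminf log_term"
      using summable_sums[OF summable_log_term] unfolding log_term_def .
    show "((\<lambda>u. (1 - u) * ln (1 - u) / (u * ln u)) has_integral suminf log_term) {0..1}"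
      using log_quotient_has_integral by (simp only: has_integral_Icc_iff_Ioo)
  qed (use int alternating_zeta_series log_telescope_series harm_zeta_series
      harm_zeta_shifted_series zeta_tail_series skew_harm_zeta_series
      Ein_quotient_has_integral binomial_zeta_series in blast)+
qed

end
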